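(* Let $\mathcal{H}_1,\mathcal{H}_2$ be Hilbert spaces over $\mathbb{F}=\mathbb{R}$ or $\mathbb{F}=\mathbb{C}$, let $K$ be a positive integer, and let $\{A_k\}_{k=1}^{K}\subset \mathcal{BC}(\mathcal{H}_1,\mathcal{H}_2)$. Assume that $\mathrm{R}(A_k)\subseteq \mathrm{N}(A_{k'}^{*})$ and $\mathrm{R}(A_k^{*})\subseteq \mathrm{N}(A_{k'})$ for each $k,k'=1,\ldots,K$, $k\neq k'$. Let $k_0\in\{1,\ldots,K\}$. The following assertions hold: (i) $A_{k_0}^{\dagger}=\left(\sum_{k=1}^{K}A_k^{*}A_k\right)^{\dagger}\left(\sum_{k=1}^{K}A_k^{*}\right)-\sum_{k=1,k\neq k_0}^{K}A_k^{\dagger}$. (ii) $\left(\sum_{k=1}^{K}A_k^{*}A_k\right)A_{k_0}^{\dagger}=A_{k_0}^{*}$ and $A_{k_0}^{\dagger}=\left(\sum_{k=1}^{K}A_k^{*}A_k\right)^{\dagger}A_{k_0}^{*}$. (iii) $\mathrm{N}\left(\sum_{k=1}^{K}A_k\right)=\{0\}$ if and only if $\mathrm{R}(A_{k_0}^{*})=\mathrm{N}\left(\sum_{k=1,k\neq k_0}^{K}A_k\right)$. (iv) If $\mathrm{N}\left(\sum_{k=1}^{K}A_k\right)=\{0\}$, then $\sum_{k=1}^{K}A_k^{*}A_k$ is invertible.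
   Context: $\mathcal{BC}(\mathcal{H}_1,\mathcal{H}_2)$ is the set of bounded linear operators from $\mathcal{H}_1$ to $\mathcal{H}_2$ with closed range. $A^{*}$, $\mathrm{N}(A)$, $\mathrm{R}(A)$ denote the adjoint, null space and range of $A$. For $A\in\mathcal{BC}(\mathcal{H}_1,\mathcal{H}_2)$, the Moore--Penrose inverse $A^{\dagger}\in\mathcal{BC}(\mathcal{H}_2,\mathcal{H}_1)$ is the unique solution $X$ of $AXA=A$, $XAX=X$, $(AX)^{*}=AX$, $(XA)^{*}=XA$. A bounded operator has a Moore--Penrose inverse if and only if its range is closed; the existence of the Moore--Penrose inverse of $\sum_{k=1}^{K}A_k^{*}A_k$ is part of the assertion. *)

theory Defs
  imports "HOL-Analysis.Analysis"
begin

class hilbert_space = real_inner + complete_space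

(* A complex inner product space also carries the real inner product space structure obtained by
   restricting scalars: inner is the real part of cinner, so norm x = sqrt (Re (cinner x x)).
   Positive definiteness of cinner comes from real_inner.
   cinner is linear in its first and conjugate-linear in its second argument. *)
class complex_inner = real_inner +
  fixes scaleC :: "complex \<Rightarrow> 'a \<Rightarrow> 'a" (infixr "*\<^sub>C" 75)
    and cinner :: "'a \<Rightarrow> 'a \<Rightarrow> complex"
  assumes scaleC_add_right: "c *\<^sub>C (x + y) = c *\<^sub>C x + c *\<^sub>C y"
    and scaleC_add_left: "(c + d) *\<^sub>C x = c *\<^sub>C x + d *\<^sub>C x"
    and scaleC_scaleC: "c *\<^sub>C d *\<^sub>C x = (c * d) *\<^sub>C x"
    and scaleC_of_real: "complex_of_real r *\<^sub>C x = r *\<^sub>R x"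
    and cinner_commute: "cinner x y = cnj (cinner y x)"
    and cinner_add_left: "cinner (x + y) z = cinner x z + cinner y z"
    and cinner_scaleC_left: "cinner (c *\<^sub>C x) y = c * cinner x y"
    and Re_cinner: "Re (cinner x y) = inner x y"

class chilbert_space = complex_inner + complete_space

instantiation complex :: chilbert_space
begin

definition "scaleC_complex (c :: complex) x = c * x"
definition "cinner_complex (x :: complex) y = x * cnj y"

instance
  by standard
    (simp_all add: scaleC_complex_def cinner_complex_def inner_complex_def algebra_simps
      complex_eq_iff scaleR_conv_of_real)

end

definition null_space :: "('a::real_normed_vector \<Rightarrow>\<^sub>L 'b::real_normed_vector) \<Rightarrow> 'a set"
  where "null_space A = {x. A x = 0}"

definition clinear_op :: "('a::complex_inner \<Rightarrow>\<^sub>L 'b::complex_inner) \<Rightarrow> bool"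
  where "clinear_op A \<longleftrightarrow> (\<forall>c x. A (c *\<^sub>C x) = c *\<^sub>C A x)"

definition BC :: "('a::hilbert_space \<Rightarrow>\<^sub>L 'b::hilbert_space) set"
  where "BC = {A. closed (range (blinfun_apply A))}"

definition cBC :: "('a::chilbert_space \<Rightarrow>\<^sub>L 'b::chilbert_space) set"
  where "cBC = {A. clinear_op A \<and> closed (range (blinfun_apply A))}"

(* Blinfun and the choice inside adjoint (like the THE in cadj) are meaningful because every bounded
   operator between Hilbert spaces has a unique, bounded adjoint. *)
definition adj :: "('a::hilbert_space \<Rightarrow>\<^sub>L 'b::hilbert_space) \<Rightarrow> 'b \<Rightarrow>\<^sub>L 'a"
  where "adj A = Blinfun (adjoint (blinfun_apply A))"

definition cadj :: "('a::chilbert_space \<Rightarrow>\<^sub>L 'b::chilbert_space) \<Rightarrow> 'b \<Rightarrow>\<^sub>L 'a"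
  where "cadj A = (THE B :: 'b \<Rightarrow>\<^sub>L 'a. \<forall>x y. cinner (A x) y = cinner x (B y))"

(* An operator A has at most one X with is_mp_inverse A X; the THE in mp_inverse is arbitrary
   exactly when the range of A is not closed. *)
definition is_mp_inverse ::
    "('a::hilbert_space \<Rightarrow>\<^sub>L 'b::hilbert_space) \<Rightarrow> ('b \<Rightarrow>\<^sub>L 'a) \<Rightarrow> bool"
  where "is_mp_inverse A X \<longleftrightarrow> X \<in> BC \<and>
    A o\<^sub>L X o\<^sub>L A = A \<and> X o\<^sub>L A o\<^sub>L X = X \<and>
    adj (A o\<^sub>L X) = A o\<^sub>L X \<and> adj (X o\<^sub>L A) = X o\<^sub>L A"

definition mp_inverse :: "('a::hilbert_space \<Rightarrow>\<^sub>L 'b::hilbert_space) \<Rightarrow> 'b \<Rightarrow>\<^sub>L 'a"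
  where "mp_inverse A = (THE X. is_mp_inverse A X)"

definition is_cmp_inverse ::
    "('a::chilbert_space \<Rightarrow>\<^sub>L 'b::chilbert_space) \<Rightarrow> ('b \<Rightarrow>\<^sub>L 'a) \<Rightarrow> bool"
  where "is_cmp_inverse A X \<longleftrightarrow> X \<in> cBC \<and>
    A o\<^sub>L X o\<^sub>L A = A \<and> X o\<^sub>L A o\<^sub>L X = X \<and>
    cadj (A o\<^sub>L X) = A o\<^sub>L X \<and> cadj (X o\<^sub>L A) = X o\<^sub>L A"

definition cmp_inverse :: "('a::chilbert_space \<Rightarrow>\<^sub>L 'b::chilbert_space) \<Rightarrow> 'b \<Rightarrow>\<^sub>L 'a"
  where "cmp_inverse A = (THE X. is_cmp_inverse A X)"

definition op_invertible :: "('a::hilbert_space \<Rightarrow>\<^sub>L 'b::hilbert_space) \<Rightarrow> bool"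
  where "op_invertible T \<longleftrightarrow> (\<exists>S. S o\<^sub>L T = id_blinfun \<and> T o\<^sub>L S = id_blinfun)"

definition cop_invertible :: "('a::chilbert_space \<Rightarrow>\<^sub>L 'b::chilbert_space) \<Rightarrow> bool"
  where "cop_invertible T \<longleftrightarrow>
    (\<exists>S. clinear_op S \<and> S o\<^sub>L T = id_blinfun \<and> T o\<^sub>L S = id_blinfun)"

end

theory Submission
  imports Defs
begin

text \<open>
  A bounded operator \<open>A\<close> with closed range is bounded below on the orthogonal complement of its null
  space (open mapping theorem), so sending \<open>y\<close> to the unique \<open>x\<close> in that complement for which \<open>A x\<close> is
  the projection of \<open>y\<close> to the range of \<open>A\<close> defines a bounded Moore--Penrose inverse.
  Writing \<open>X\<^sub>k\<close> for the inverse of \<open>A\<^sub>k\<close>, the identities \<open>X\<^sub>k = A\<^sub>k\<^sup>* X\<^sub>k\<^sup>* X\<^sub>k = X\<^sub>k X\<^sub>k\<^sup>* A\<^sub>k\<^sup>*\<close> carry the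
  orthogonality of the \<open>A\<^sub>k\<close> over to the \<open>X\<^sub>k\<close>, all mixed products vanish, and
  \<open>\<Sum>\<^sub>k X\<^sub>k X\<^sub>k\<^sup>*\<close> is the Moore--Penrose inverse of \<open>\<Sum>\<^sub>k A\<^sub>k\<^sup>* A\<^sub>k\<close>; the assertions are then algebra.
  A complex Hilbert space is also a real one, and for complex-linear operators the complex adjoint and
  Moore--Penrose inverse coincide with the real ones, which reduces the complex case to the real case.
\<close>

subsection \<open>Hilbert spaces and closed ranges\<close>

instance hilbert_space \<subseteq> banach ..

instance chilbert_space \<subseteq> hilbert_space ..

text \<open>The representing vector is the minimiser over \<open>M\<close> of
  \<open>J x = (norm x)^2 - 2 * f x\<close>. When \<open>f\<close> is the inner product with a fixed
  \<open>x\<close>, \<open>J u\<close> differs from \<open>(norm (x - u))^2\<close> only by a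
  constant, so the same statement also yields orthogonal projections.\<close>

lemma riesz_on_closed_subspace:
  fixes f :: "'a::hilbert_space \<Rightarrow> real"
  assumes M: "closed M" "subspace M" and f: "bounded_linear f"
  shows "\<exists>x\<in>M. \<forall>y\<in>M. inner x y = f y"
proof -
  interpret f: bounded_linear f by fact
  obtain c where c: "\<And>x. \<bar>f x\<bar> \<le> norm x * c"
    using f.nonneg_bounded by auto
  define J where "J x = (norm x)\<^sup>2 - 2 * f x" for x
  have lower: "- c\<^sup>2 \<le> J x" for x
  proof -
    have "0 \<le> (norm x - c)\<^sup>2" by simp
    then show ?thesis using c[of x] by (simp add: J_def power2_eq_square algebra_simps abs_le_iff)
  qed
  define m where "m = Inf (J ` M)"
  have "0 \<in> M" using M by (simp add: subspace_0)
  have bdd: "bdd_below (J ` M)" using lower by (intro bdd_belowI) auto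
  have m_le: "m \<le> J x" if "x \<in> M" for x
    unfolding m_def using that bdd by (intro cInf_lower) auto
  define h where "h n = inverse (real (Suc n))" for n
  have "\<exists>x\<in>M. J x < m + h n" for n
  proof -
    have "h n > 0" by (simp add: h_def)
    then have "\<exists>v\<in>J ` M. v < m + h n"
      using \<open>0 \<in> M\<close> bdd by (subst cInf_less_iff[symmetric]) (auto simp: m_def[symmetric])
    then show ?thesis by auto
  qed
  then obtain x where xM: "\<And>n. x n \<in> M" and xJ: "\<And>n. J (x n) < m + h n"
    by metis
  \<comment> \<open>By the parallelogram law, near-minimisers of \<open>J\<close> are close to each other.\<close>
  have gap: "(norm (u - v))\<^sup>2 \<le> 2 * (J u - m) + 2 * (J v - m)" if "u \<in> M" "v \<in> M" for u v
  proof -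
    have "m \<le> J ((1/2) *\<^sub>R (u + v))"
      using that M by (intro m_le) (simp add: subspace_add subspace_scale)
    moreover have "4 * J ((1/2) *\<^sub>R (u + v)) = 2 * J u + 2 * J v - (norm (u - v))\<^sup>2"
      by (simp add: J_def power2_norm_eq_inner inner_simps f.scaleR f.add inner_commute field_simps)
    ultimately show ?thesis by simp
  qed
  have "Cauchy x"
  proof (rule metric_CauchyI)
    fix e :: real assume "e > 0"
    \<comment> \<open>\<open>gap\<close> bounds the squared distance of two terms beyond
      \<open>N\<close> by \<open>2 * h i + 2 * h j\<close>, hence by \<open>4 * h N\<close>.\<close>
    then obtain N where N: "h N < e\<^sup>2 / 4"
      using reals_Archimedean[of "e\<^sup>2 / 4"] by (auto simp: h_def)
    have "dist (x i) (x j) < e" if "i \<ge> N" "j \<ge> N" for i j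
    proof -
      have "h i \<le> h N" "h j \<le> h N"
        using that by (simp_all add: h_def le_imp_inverse_le)
      then have "(norm (x i - x j))\<^sup>2 < e\<^sup>2"
        using order_le_less_trans[OF gap[OF xM[of i] xM[of j]], of "e\<^sup>2"] xJ[of i] xJ[of j] N
        by (simp add: field_simps)
      then show ?thesis
        using \<open>e > 0\<close> by (simp add: dist_norm power2_less_imp_less)
    qed
    then show "\<exists>N. \<forall>i\<ge>N. \<forall>j\<ge>N. dist (x i) (x j) < e" by blast
  qed
  then obtain z where z: "x \<longlonglongrightarrow> z"
    using Cauchy_convergent convergent_def by blast
  have zM: "z \<in> M" using closed_sequentially[OF M(1) xM z] .
  have "(\<lambda>n. J (x n)) \<longlonglongrightarrow> J z"
    unfolding J_def by (intro tendsto_intros f.tendsto z)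
  moreover have "(\<lambda>n. m + h n) \<longlonglongrightarrow> m + 0"
    unfolding h_def by (intro tendsto_add tendsto_const LIMSEQ_inverse_real_of_nat)
  ultimately have "J z \<le> m + 0"
    using xJ by (intro LIMSEQ_le) (auto intro: less_imp_le)
  then have Jz: "J z \<le> J u" if "u \<in> M" for u using m_le[OF that] by simp
  have "inner z y = f y" if y: "y \<in> M" for y
  proof (cases "y = 0")
    case False
    define d where "d = inner z y - f y"
    \<comment> \<open>This \<open>t\<close> minimises
      \<open>J (z + t y) - J z = 2 t d + t^2 (inner y y)\<close>; the minimum
      \<open>- d^2 / inner y y\<close> cannot be negative, so \<open>d = 0\<close>.\<close>
    define t where "t = - (d / inner y y)"
    have "J z \<le> J (z + t *\<^sub>R y)"
      using y zM M by (intro Jz) (simp add: subspace_add subspace_scale)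
    also have "\<dots> = J z + (2 * t * d + t * t * inner y y)"
      by (simp add: J_def d_def power2_norm_eq_inner inner_simps f.scaleR f.add inner_commute algebra_simps)
    also have "2 * t * d + t * t * inner y y = - (d * d / inner y y)"
      using False by (simp add: t_def field_simps)
    finally have "d * d / inner y y \<le> 0" by simp
    moreover have "inner y y > 0" using False by simp
    ultimately have "d * d \<le> 0" by (simp only: divide_le_0_iff) linarith
    then show ?thesis by (auto simp: d_def mult_le_0_iff)
  qed (simp add: f.zero)
  then show ?thesis using zM by blast
qed

lemma orthogonal_projection_exists:
  fixes M :: "'a::hilbert_space set"
  assumes "closed M" "subspace M"
  shows "\<exists>p\<in>M. \<forall>y\<in>M. inner (x - p) y = 0"
  using riesz_on_closed_subspace[OF assms bounded_linear_inner_right[of x]]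
  by (simp add: inner_diff_left) metis

text \<open>This gives \<open>adj\<close> its meaning. Riesz representation on the whole space
  produces a pointwise adjoint \<open>g\<close>; it is linear because representing vectors are
  unique, and bounded by testing its defining identity at \<open>g u\<close>. It is then the
  function that \<open>adjoint\<close> selects.\<close>

lemma inner_adj:
  fixes A :: "'a::hilbert_space \<Rightarrow>\<^sub>L 'b::hilbert_space"
  shows "inner x (adj A y) = inner (A x) y"
proof -
  have "bounded_linear (\<lambda>x. inner (A x) y)" for y
    by (intro bounded_linear_intros)
  from riesz_on_closed_subspace[OF closed_UNIV subspace_UNIV this]
  obtain g where g: "\<And>x y. inner (A x) y = inner x (g y)"
    by (metis UNIV_I inner_commute)
  have "bounded_linear g"
  proof (rule bounded_linear_intro)
    show "g (u + v) = g u + g v" for u v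
      by (rule vector_eq_ldot[THEN iffD1]) (simp add: inner_simps g[symmetric])
    show "g (r *\<^sub>R u) = r *\<^sub>R g u" for r u
      by (rule vector_eq_ldot[THEN iffD1]) (simp add: inner_simps g[symmetric])
    show "norm (g u) \<le> norm u * norm A" for u
    proof -
      have "norm (g u) * norm (g u) = inner (A (g u)) u"
        by (simp add: g flip: power2_eq_square power2_norm_eq_inner)
      also have "\<dots> \<le> norm (A (g u)) * norm u" by (rule norm_cauchy_schwarz)
      also have "\<dots> \<le> norm A * norm (g u) * norm u"
        by (intro mult_right_mono norm_blinfun) simp
      finally have "norm (g u) * norm (g u) \<le> norm (g u) * (norm u * norm A)"
        by (simp add: algebra_simps)
      then show ?thesis
        by (cases "norm (g u) = 0") (auto simp: mult_le_cancel_left)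
    qed
  qed
  moreover have "adjoint (blinfun_apply A) = g" using g by (intro adjoint_unique) simp
  ultimately show ?thesis by (simp add: adj_def bounded_linear_Blinfun_apply g)
qed

section \<open>Calculus of adjoints\<close>

lemma adj_unique:
  fixes A :: "'a::hilbert_space \<Rightarrow>\<^sub>L 'b::hilbert_space" and B :: "'b \<Rightarrow>\<^sub>L 'a"
  assumes "\<And>x y. inner (A x) y = inner x (B y)"
  shows "adj A = B"
  by (rule blinfun_eqI, rule vector_eq_ldot[THEN iffD1]) (simp add: inner_adj assms)

lemma adj_adj [simp]: "adj (adj A) = A"
  for A :: "'a::hilbert_space \<Rightarrow>\<^sub>L 'b::hilbert_space"
  by (rule adj_unique) (metis inner_adj inner_commute)

lemma adj_compose: "adj (A o\<^sub>L B) = adj B o\<^sub>L adj A"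
  for A :: "'b::hilbert_space \<Rightarrow>\<^sub>L 'c::hilbert_space" and B :: "'a::hilbert_space \<Rightarrow>\<^sub>L 'b"
  by (rule adj_unique) (simp add: inner_adj)

lemma adj_sum: "adj (\<Sum>k\<in>I. A k) = (\<Sum>k\<in>I. adj (A k))"
  for A :: "'i \<Rightarrow> 'a::hilbert_space \<Rightarrow>\<^sub>L 'b::hilbert_space"
  by (rule adj_unique) (simp add: blinfun.sum_left inner_sum_left inner_sum_right inner_adj)

lemma adj_0 [simp]: "adj (0 :: 'a::hilbert_space \<Rightarrow>\<^sub>L 'b::hilbert_space) = 0"
  by (rule adj_unique) simp

text \<open>The open mapping theorem, in the form of norm-controlled preimages.\<close>

lemma closed_range_bounded_preimage:
  fixes A :: "'a::banach \<Rightarrow>\<^sub>L 'b::banach"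
  assumes closed: "closed (range A)"
  shows "\<exists>c. \<forall>y\<in>range A. \<exists>x. A x = y \<and> norm x \<le> c * norm y"
proof -
  define R where "R = range A"
  define B where "B n = closure (A ` cball 0 (real n))" for n
  have R: "closed R" "subspace R"
    using closed by (auto simp: R_def intro!: linear_subspace_image blinfun.bounded_linear_right bounded_linear.linear)
  have BR: "B n \<subseteq> R" for n
    unfolding B_def by (rule closure_minimal) (use R in \<open>auto simp: R_def\<close>)
  have cover: "R \<subseteq> (\<Union>n. B n)"
  proof
    fix y assume "y \<in> R"
    then obtain x where x: "y = A x" by (auto simp: R_def)
    obtain n where "norm x \<le> real n" using real_arch_simple by blast
    then have "y \<in> A ` cball 0 (real n)" using x by auto
    then show "y \<in> (\<Union>n. B n)" using closure_subset by (fastforce simp: B_def)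
  qed
  \<comment> \<open>Baire category: \<open>R\<close> is closed, hence completely metrizable, and is
    covered by countably many closed sets \<open>B n\<close>.\<close>
  have "\<exists>n. top_of_set R interior_of B n \<noteq> {}"
  proof (rule ccontr)
    assume "\<not> ?thesis"
    then have "top_of_set R interior_of \<Union> (range B) = {}"
      using R BR by (intro Baire_category_alt disjI1)
        (auto intro!: completely_metrizable_space_closedin[OF completely_metrizable_space_euclidean]
           closed_subset simp: B_def)
    moreover have "\<Union> (range B) = R" using cover BR by blast
    ultimately show False
      using R subspace_0 interior_of_topspace[of "top_of_set R"] by fastforce
  qed
  then obtain n y0 where "y0 \<in> top_of_set R interior_of B n" by blast
  then obtain U where U: "openin (top_of_set R) U" "y0 \<in> U" "U \<subseteq> B n"
    by (auto simp: interior_of_def)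
  then obtain r where r: "r > 0" "\<And>y. y \<in> R \<Longrightarrow> dist y y0 < r \<Longrightarrow> y \<in> B n"
    unfolding openin_euclidean_subtopology_iff by (metis subsetD)
  have y0: "y0 \<in> R" using U openin_imp_subset by blast
  have sym: "- y \<in> B n" if "y \<in> B n" for y
  proof -
    obtain f where f: "\<And>k. f k \<in> A ` cball 0 (real n)" "f \<longlonglongrightarrow> y"
      using \<open>y \<in> B n\<close> by (auto simp: B_def closure_sequential)
    have "- f k \<in> A ` cball 0 (real n)" for k
      using f(1)[of k] by (force simp: image_iff blinfun.minus_right intro: bexI[of _ "- _"])
    then show ?thesis
      using tendsto_minus[OF f(2)] unfolding B_def closure_sequential by (intro exI[of _ "\<lambda>k. - f k"]) simp
  qed
  have conv: "convex (B n)"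
    unfolding B_def by (intro convex_closure convex_linear_image convex_cball)
      (auto intro: bounded_linear.linear blinfun.bounded_linear_right)
  \<comment> \<open>The ball around \<open>y0\<close> is moved to the origin: \<open>y\<close> is
    the midpoint of \<open>y0 + y\<close> and \<open>- (y0 - y)\<close>, so symmetry and convexity
    of \<open>B n\<close> apply.\<close>
  have small: "y \<in> B n" if "y \<in> R" "norm y < r" for y
  proof -
    have "y0 + y \<in> B n" "- (y0 - y) \<in> B n"
      using that y0 R by (auto intro!: r sym simp del: minus_diff_eq simp: dist_norm subspace_add subspace_diff)
    then have "(1/2) *\<^sub>R (y0 + y) + (1/2) *\<^sub>R (- (y0 - y)) \<in> B n"
      using conv by (intro convexD) auto
    also have "(1/2) *\<^sub>R (y0 + y) + (1/2) *\<^sub>R (- (y0 - y)) = y"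
      by (simp add: algebra_simps flip: scaleR_left.add)
    finally show ?thesis .
  qed
  \<comment> \<open>Scaling \<open>y\<close> by \<open>s = r / (2 * norm y)\<close> gives norm
    \<open>r / 2\<close>, inside the ball. An approximation within \<open>r / 4\<close> by
    \<open>A x\<close> with \<open>norm x\<close> at most \<open>n\<close>, scaled back, has error
    at most \<open>norm y / 2\<close> and preimage norm at most \<open>c * norm y\<close>.\<close>
  define c where "c = 2 * real n / r"
  have c0: "c \<ge> 0" using r by (simp add: c_def)
  have approx: "\<exists>x. norm x \<le> c * norm y \<and> norm (y - A x) \<le> norm y / 2" if y: "y \<in> R" for y
  proof (cases "y = 0")
    case False
    define s where "s = r / (2 * norm y)"
    have s: "s > 0" using False r by (simp add: s_def)
    have "s *\<^sub>R y \<in> B n"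
      using y R r False by (intro small) (simp_all add: subspace_scale s_def)
    moreover have "r / 4 > 0" using r by simp
    ultimately obtain x where x: "norm x \<le> real n" "dist (A x) (s *\<^sub>R y) < r / 4"
      unfolding B_def closure_approachable by fastforce
    have "y - A ((1 / s) *\<^sub>R x) = (1 / s) *\<^sub>R (s *\<^sub>R y - A x)"
      using s by (simp add: blinfun.scaleR_right algebra_simps)
    then have "norm (y - A ((1 / s) *\<^sub>R x)) = (1 / s) * dist (A x) (s *\<^sub>R y)"
      using s by (simp add: dist_norm norm_minus_commute)
    also have "\<dots> \<le> (1 / s) * (r / 4)" using x s by (intro mult_left_mono) auto
    also have "\<dots> = norm y / 2" using False r by (simp add: s_def field_simps)
    finally have 1: "norm (y - A ((1 / s) *\<^sub>R x)) \<le> norm y / 2" .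
    have "norm ((1 / s) *\<^sub>R x) \<le> (1 / s) * real n" using x s by (simp add: divide_right_mono)
    also have "\<dots> = c * norm y" using False r by (simp add: s_def c_def field_simps)
    finally show ?thesis using 1 by blast
  qed (auto intro: exI[of _ 0])
  then obtain g where g: "\<And>y. y \<in> R \<Longrightarrow> norm (g y) \<le> c * norm y"
      "\<And>y. y \<in> R \<Longrightarrow> norm (y - A (g y)) \<le> norm y / 2"
    by metis
  have "\<exists>x. A x = y \<and> norm x \<le> (2 * c) * norm y" if y: "y \<in> R" for y
  proof -
    \<comment> \<open>Successive residuals, at least halved at each step. The corrections
      \<open>g (e i)\<close> are dominated by a geometric series, and their images telescope to
      \<open>y\<close>.\<close>
    define e where "e i = ((\<lambda>v. v - A (g v)) ^^ i) y" for i
    have e_Suc: "e (Suc i) = e i - A (g (e i))" for i by (simp add: e_def)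
    have eR: "e i \<in> R" for i
      by (induction i) (use y R in \<open>auto simp: e_def R_def intro: subspace_diff\<close>)
    have e_le: "norm (e i) \<le> norm y * (1/2) ^ i" for i
    proof (induction i)
      case (Suc i)
      then show ?case using g(2)[OF eR, of i] by (simp add: e_Suc)
    qed (simp add: e_def)
    have ge_le: "norm (g (e i)) \<le> c * norm y * (1/2) ^ i" for i
      using order_trans[OF g(1)[OF eR] mult_left_mono[OF e_le c0]] by (simp add: algebra_simps)
    have geo: "(\<lambda>i. c * norm y * (1/2) ^ i) sums (c * norm y * 2)"
      using geometric_sums[of "1/2 :: real"] by (intro sums_mult) simp
    have sm: "summable (\<lambda>i. g (e i))"
      using ge_le by (intro summable_comparison_test[OF _ sums_summable[OF geo]]) auto
    define x where "x = (\<Sum>i. g (e i))"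
    have nx: "norm x \<le> c * norm y * 2"
      unfolding x_def sums_unique[OF geo] by (rule norm_suminf_le[OF ge_le sums_summable[OF geo]])
    have part: "(\<Sum>i<N. A (g (e i))) = y - e N" for N
      by (induction N) (simp_all add: e_Suc, simp add: e_def)
    have "(\<lambda>N. norm y * (1/2) ^ N) \<longlonglongrightarrow> norm y * 0"
      by (intro tendsto_mult tendsto_const LIMSEQ_power_zero) simp
    then have "e \<longlonglongrightarrow> 0"
      using e_le by (intro Lim_null_comparison[of e "\<lambda>N. norm y * (1/2) ^ N"]) auto
    then have "(\<lambda>N. y - e N) \<longlonglongrightarrow> y - 0" by (intro tendsto_intros)
    then have "(\<lambda>i. A (g (e i))) sums y" by (simp add: sums_def part)
    moreover have "(\<lambda>i. A (g (e i))) sums A x"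
      unfolding x_def by (intro bounded_linear.sums[OF blinfun.bounded_linear_right] summable_sums sm)
    ultimately have "A x = y" using sums_unique2 by blast
    then show ?thesis using nx by (auto simp: algebra_simps)
  qed
  then show ?thesis unfolding R_def by blast
qed

subsection \<open>Moore--Penrose inverses\<close>

lemma blinfun_compose_assoc: "A o\<^sub>L B o\<^sub>L C = A o\<^sub>L (B o\<^sub>L C)"
  by (rule blinfun_eqI) simp

text \<open>Since \<open>A Y A = A\<close>, the product \<open>A X\<close> equals
  \<open>(A Y) (A X)\<close>; taking adjoints reverses the factors and collapses the product to
  \<open>A Y\<close>. Symmetrically \<open>X A = Y A\<close>, and then
  \<open>X = X A X = Y A Y = Y\<close>.\<close>

lemma is_mp_inverse_unique:
  fixes A :: "'a::hilbert_space \<Rightarrow>\<^sub>L 'b::hilbert_space"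
  assumes X: "is_mp_inverse A X" and Y: "is_mp_inverse A Y"
  shows "X = Y"
proof -
  note cX = X[unfolded is_mp_inverse_def] and cY = Y[unfolded is_mp_inverse_def]
  have "A o\<^sub>L X = adj ((A o\<^sub>L Y o\<^sub>L A) o\<^sub>L X)" using cX cY by simp
  also have "\<dots> = adj ((A o\<^sub>L Y) o\<^sub>L (A o\<^sub>L X))" by (simp add: blinfun_compose_assoc)
  also have "\<dots> = (A o\<^sub>L X) o\<^sub>L (A o\<^sub>L Y)"
    using cX cY by (simp only: adj_compose[of "A o\<^sub>L Y" "A o\<^sub>L X"])
  also have "\<dots> = (A o\<^sub>L X o\<^sub>L A) o\<^sub>L Y" by (simp add: blinfun_compose_assoc)
  finally have AX: "A o\<^sub>L X = A o\<^sub>L Y" using cX by simp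
  have "X o\<^sub>L A = adj (X o\<^sub>L (A o\<^sub>L Y o\<^sub>L A))" using cX cY by simp
  also have "\<dots> = adj ((X o\<^sub>L A) o\<^sub>L (Y o\<^sub>L A))" by (simp add: blinfun_compose_assoc)
  also have "\<dots> = (Y o\<^sub>L A) o\<^sub>L (X o\<^sub>L A)"
    using cX cY by (simp only: adj_compose[of "X o\<^sub>L A" "Y o\<^sub>L A"])
  also have "\<dots> = Y o\<^sub>L (A o\<^sub>L X o\<^sub>L A)" by (simp add: blinfun_compose_assoc)
  finally have XA: "X o\<^sub>L A = Y o\<^sub>L A" using cX by simp
  have "X = X o\<^sub>L A o\<^sub>L X" using cX by simp
  also have "\<dots> = Y o\<^sub>L (A o\<^sub>L X)" by (simp add: XA blinfun_compose_assoc)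
  also have "\<dots> = Y" using cY by (simp add: AX flip: blinfun_compose_assoc)
  finally show ?thesis .
qed

lemma mp_inverse_eqI: "is_mp_inverse A X \<Longrightarrow> mp_inverse A = X"
  unfolding mp_inverse_def using is_mp_inverse_unique by (blast intro: the_equality)

text \<open>The range of \<open>X\<close> is the fixed-point set of the continuous map
  \<open>X A\<close>, hence closed.\<close>

lemma in_BC_if_inner_inverse:
  assumes "X o\<^sub>L A o\<^sub>L X = X"
  shows "X \<in> BC"
proof -
  have "X (A (X y)) = X y" for y
    using arg_cong[OF assms, of "\<lambda>T. T y"] by simp
  then have "range X = {x. X (A x) = x}" by (auto intro: range_eqI[OF sym])
  moreover have "closed {x. X (A x) = x}"
    by (intro closed_Collect_eq continuous_intros)
  ultimately show ?thesis by (simp add: BC_def)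
qed

lemma is_mp_inverseI:
  assumes "A o\<^sub>L X o\<^sub>L A = A" "X o\<^sub>L A o\<^sub>L X = X"
    and "adj (A o\<^sub>L X) = A o\<^sub>L X" "adj (X o\<^sub>L A) = X o\<^sub>L A"
  shows "is_mp_inverse A X"
  using assms in_BC_if_inner_inverse[OF assms(2)] by (simp add: is_mp_inverse_def)

lemma mp_inverse_exists:
  fixes A :: "'a::hilbert_space \<Rightarrow>\<^sub>L 'b::hilbert_space"
  assumes "A \<in> BC"
  shows "\<exists>X. is_mp_inverse A X"
proof -
  have closed_R: "closed (range A)" using assms by (simp add: BC_def)
  have sub_R: "subspace (range A)"
    by (intro linear_subspace_image bounded_linear.linear blinfun.bounded_linear_right) simp
  define N where "N = null_space A"
  have N: "closed N" "subspace N"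
    unfolding N_def null_space_def
    by (intro closed_Collect_eq continuous_intros)
      (auto simp: subspace_def blinfun.bilinear_simps)
  have decomp: "\<exists>x. A x = A u \<and> (\<forall>v\<in>N. inner x v = 0)" for u
  proof -
    obtain p where "p \<in> N" "\<forall>v\<in>N. inner (u - p) v = 0"
      using orthogonal_projection_exists[OF N] by blast
    then show ?thesis by (intro exI[of _ "u - p"]) (simp add: N_def null_space_def blinfun.diff_right)
  qed
  have "\<exists>x. (\<forall>v\<in>N. inner x v = 0) \<and> (\<forall>u. inner (y - A x) (A u) = 0)" for y
  proof -
    obtain u where "\<forall>v\<in>range A. inner (y - A u) v = 0"
      using orthogonal_projection_exists[OF closed_R sub_R] by blast
    then show ?thesis using decomp[of u] by (metis rangeI)
  qed
  \<comment> \<open>\<open>g y\<close> is the least-squares solution of minimal norm. The two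
    orthogonality conditions determine it (\<open>g_unique\<close>), which later yields linearity
    and \<open>X A X = X\<close>.\<close>
  then obtain g where gN: "\<And>y v. A v = 0 \<Longrightarrow> inner (g y) v = 0"
    and gR: "\<And>y u. inner (y - A (g y)) (A u) = 0"
    by (metis (mono_tags) N_def null_space_def mem_Collect_eq)
  have g_unique: "g y = x"
    if "\<And>v. A v = 0 \<Longrightarrow> inner x v = 0" "\<And>u. inner (y - A x) (A u) = 0" for x y
  proof -
    \<comment> \<open>The first argument is \<open>A (x - g y)\<close> itself, so this vector is
      orthogonal to itself. Then \<open>x - g y\<close> lies in the null space and is orthogonal to
      it.\<close>
    have "inner (y - A (g y) - (y - A x)) (A (x - g y)) = 0"
      using gR that(2) by (simp only: inner_diff_left)
    then have "A (x - g y) = 0" by (simp add: blinfun.diff_right)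
    then have "inner (x - g y) (x - g y) = 0"
      using that(1) gN by (simp only: inner_diff_left[of x])
    then show ?thesis by simp
  qed
  obtain c where c: "\<And>y. y \<in> range A \<Longrightarrow> \<exists>x. A x = y \<and> norm x \<le> c * norm y"
    using closed_range_bounded_preimage[OF closed_R] by blast
  have bound: "norm (g y) \<le> norm y * \<bar>c\<bar>" for y
  proof -
    \<comment> \<open>Any preimage \<open>x\<close> of \<open>A (g y)\<close> differs from
      \<open>g y\<close> by a null vector orthogonal to \<open>g y\<close>, so
      \<open>norm (g y)\<close> is at most \<open>norm x\<close>. The absolute value of
      \<open>c\<close> is taken because its sign is unknown.\<close>
    obtain x where x: "A x = A (g y)" "norm x \<le> c * norm (A (g y))" using c by blast
    have "inner (g y) (x - g y) = 0" using x by (intro gN) (simp add: blinfun.diff_right)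
    then have "(norm (g y))\<^sup>2 = inner (g y) x" by (simp add: power2_norm_eq_inner inner_diff_right)
    also have "\<dots> \<le> norm (g y) * norm x" by (rule norm_cauchy_schwarz)
    finally have "norm (g y) \<le> norm x"
      by (cases "norm (g y) = 0") (simp_all add: power2_eq_square)
    also have "\<dots> \<le> \<bar>c\<bar> * norm (A (g y))"
      using x(2) by (meson abs_ge_self mult_right_mono norm_ge_zero order_trans)
    also have "\<dots> \<le> \<bar>c\<bar> * norm y"
    proof (rule mult_left_mono)
      have "(norm (A (g y)))\<^sup>2 = inner y (A (g y))"
        using gR[of y "g y"] by (simp add: power2_norm_eq_inner inner_diff_left)
      also have "\<dots> \<le> norm y * norm (A (g y))" by (rule norm_cauchy_schwarz)
      finally show "norm (A (g y)) \<le> norm y"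
        by (cases "norm (A (g y)) = 0") (simp_all add: power2_eq_square)
    qed simp
    finally show ?thesis by (simp add: mult.commute)
  qed
  have "bounded_linear g"
  proof (rule bounded_linear_intro)
    show "g (u + v) = g u + g v" for u v
    proof (rule g_unique)
      show "inner (u + v - A (g u + g v)) (A w) = 0" for w
        using gR[of u w] gR[of v w] by (simp add: blinfun.add_right inner_simps)
    qed (simp add: inner_simps gN)
    show "g (r *\<^sub>R u) = r *\<^sub>R g u" for r u
    proof (rule g_unique)
      show "inner (r *\<^sub>R u - A (r *\<^sub>R g u)) (A w) = 0" for w
        using gR[of u w] by (simp add: blinfun.scaleR_right inner_simps)
    qed (simp add: inner_simps gN)
  qed (rule bound)
  then obtain X where X: "\<And>y. blinfun_apply X y = g y" by (metis bounded_linear_Blinfun_apply)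
  \<comment> \<open>For the datum \<open>A u\<close> the residual is \<open>A (u - g (A u))\<close>,
    which lies in the range and is orthogonal to it.\<close>
  have AXA: "A (g (A u)) = A u" for u
    using gR[of "A u" "u - g (A u)"] by (simp add: blinfun.diff_right)
  have "is_mp_inverse A X"
  proof (rule is_mp_inverseI)
    show "A o\<^sub>L X o\<^sub>L A = A" by (rule blinfun_eqI) (simp add: X AXA)
    show "X o\<^sub>L A o\<^sub>L X = X"
      by (rule blinfun_eqI) (simp add: X, rule g_unique, simp_all add: gN)
    show "adj (A o\<^sub>L X) = A o\<^sub>L X"
    proof (rule adj_unique)
      fix y z
      show "inner ((A o\<^sub>L X) y) z = inner y ((A o\<^sub>L X) z)"
        \<comment> \<open>Both sides equal \<open>inner (A (g y)) (A (g z))\<close>.\<close>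
        using gR[of y "g z"] gR[of z "g y"] by (simp add: X inner_diff_left inner_diff_right inner_commute)
    qed
    show "adj (X o\<^sub>L A) = X o\<^sub>L A"
    proof (rule adj_unique)
      fix u v
      have "inner (g (A u)) (v - g (A v)) = 0" "inner (g (A v)) (u - g (A u)) = 0"
        by (auto intro!: gN simp: blinfun.diff_right AXA)
      then show "inner ((X o\<^sub>L A) u) v = inner u ((X o\<^sub>L A) v)"
        by (simp add: X inner_diff_left inner_diff_right inner_commute)
    qed
  qed
  then show ?thesis by blast
qed

lemma is_mp_inverse_mp_inverse:
  "A \<in> BC \<Longrightarrow> is_mp_inverse A (mp_inverse A)"
  using mp_inverse_exists mp_inverse_eqI by metis

text \<open>All follow from \<open>adj X adj A = A X\<close> and \<open>adj A adj X = X A\<close>.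
  The last two factor \<open>X\<close> through \<open>adj A\<close> on either side, so a product
  that vanishes with \<open>adj A\<close> vanishes with \<open>X\<close> as well.\<close>

lemma
  assumes "is_mp_inverse A X"
  shows adj_adj_mp: "adj A o\<^sub>L adj X = X o\<^sub>L A"
    and adj_op_mp: "adj A o\<^sub>L A o\<^sub>L X = adj A"
    and mp_op_adj: "X o\<^sub>L A o\<^sub>L adj A = adj A"
    and mp_adj_mp_adj: "X o\<^sub>L adj X o\<^sub>L adj A = X"
    and adj_adj_mp_mp: "adj A o\<^sub>L adj X o\<^sub>L X = X"
proof -
  note c = assms[unfolded is_mp_inverse_def]
  show 1: "adj A o\<^sub>L adj X = X o\<^sub>L A" using c by (simp flip: adj_compose)
  have 2: "adj X o\<^sub>L adj A = A o\<^sub>L X" using c by (simp flip: adj_compose)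
  have "adj (A o\<^sub>L X o\<^sub>L A) = adj A" using c by simp
  then have "adj A o\<^sub>L (adj X o\<^sub>L adj A) = adj A" by (simp add: adj_compose)
  then show "adj A o\<^sub>L A o\<^sub>L X = adj A" "X o\<^sub>L A o\<^sub>L adj A = adj A"
    by (simp add: 2 blinfun_compose_assoc, simp add: blinfun_compose_assoc flip: 1)
  show "X o\<^sub>L adj X o\<^sub>L adj A = X" "adj A o\<^sub>L adj X o\<^sub>L X = X"
    using c by (simp_all add: 1 2 blinfun_compose_assoc)
qed

subsection \<open>Families of mutually orthogonal operators\<close>

lemma sum_compose_sum_orthogonal:
  fixes f :: "'i \<Rightarrow> 'b::real_normed_vector \<Rightarrow>\<^sub>L 'c::real_normed_vector"
    and g :: "'i \<Rightarrow> 'a::real_normed_vector \<Rightarrow>\<^sub>L 'b"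
  assumes "finite I" "\<And>j k. j \<in> I \<Longrightarrow> k \<in> I \<Longrightarrow> j \<noteq> k \<Longrightarrow> f j o\<^sub>L g k = 0"
  shows "(\<Sum>k\<in>I. f k) o\<^sub>L (\<Sum>k\<in>I. g k) = (\<Sum>k\<in>I. f k o\<^sub>L g k)"
proof -
  have "(\<Sum>k\<in>I. f k) o\<^sub>L (\<Sum>k\<in>I. g k) = (\<Sum>j\<in>I. \<Sum>k\<in>I. f j o\<^sub>L g k)"
    by (simp add: bounded_bilinear.sum_left[OF bounded_bilinear_blinfun_compose]
        bounded_bilinear.sum_right[OF bounded_bilinear_blinfun_compose]) (rule sum.swap)
  also have "\<dots> = (\<Sum>j\<in>I. \<Sum>k\<in>I. if k = j then f j o\<^sub>L g j else 0)"
    using assms(2) by (intro sum.cong) auto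
  also have "\<dots> = (\<Sum>j\<in>I. f j o\<^sub>L g j)" using assms(1) by simp
  finally show ?thesis .
qed

lemma sum_compose_single:
  fixes f :: "'i \<Rightarrow> 'b::real_normed_vector \<Rightarrow>\<^sub>L 'c::real_normed_vector"
    and g :: "'a::real_normed_vector \<Rightarrow>\<^sub>L 'b"
  assumes "finite I" "i \<in> I" "\<And>k. k \<in> I \<Longrightarrow> k \<noteq> i \<Longrightarrow> f k o\<^sub>L g = 0"
  shows "(\<Sum>k\<in>I. f k) o\<^sub>L g = f i o\<^sub>L g"
proof -
  have "(\<Sum>k\<in>I. f k) o\<^sub>L g = (\<Sum>k\<in>I. f k o\<^sub>L g)"
    by (rule bounded_bilinear.sum_left[OF bounded_bilinear_blinfun_compose])
  also have "\<dots> = (\<Sum>k\<in>I. if k = i then f i o\<^sub>L g else 0)"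
    using assms(3) by (intro sum.cong) auto
  also have "\<dots> = f i o\<^sub>L g" using assms by simp
  finally show ?thesis .
qed

lemma compose_eq_0_middle:
  assumes "B o\<^sub>L C = 0"
  shows "A o\<^sub>L B o\<^sub>L (C o\<^sub>L D) = 0"
proof -
  have "A o\<^sub>L B o\<^sub>L (C o\<^sub>L D) = A o\<^sub>L (B o\<^sub>L C) o\<^sub>L D" by (simp only: blinfun_compose_assoc)
  then show ?thesis using assms by simp
qed

text \<open>Stated for real Hilbert spaces only; it serves complex families too, once their adjoints
  are identified with the real ones.\<close>

locale orthogonal_operators =
  fixes A :: "'i \<Rightarrow> 'a::hilbert_space \<Rightarrow>\<^sub>L 'b::hilbert_space" and I :: "'i set"
  assumes finite: "finite I"
    and closed_range: "\<And>k. k \<in> I \<Longrightarrow> A k \<in> BC"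
    and range_subset: "\<And>j k. j \<in> I \<Longrightarrow> k \<in> I \<Longrightarrow> j \<noteq> k \<Longrightarrow> range (A j) \<subseteq> null_space (adj (A k))"
    and range_adj_subset: "\<And>j k. j \<in> I \<Longrightarrow> k \<in> I \<Longrightarrow> j \<noteq> k \<Longrightarrow> range (adj (A j)) \<subseteq> null_space (A k)"
begin

abbreviation X where "X k \<equiv> mp_inverse (A k)"

abbreviation T where "T \<equiv> \<Sum>k\<in>I. adj (A k) o\<^sub>L A k"

abbreviation S where "S \<equiv> \<Sum>k\<in>I. X k o\<^sub>L adj (X k)"

lemma X: "k \<in> I \<Longrightarrow> is_mp_inverse (A k) (X k)"
  by (simp add: closed_range is_mp_inverse_mp_inverse)

lemmas A_X_A = X[unfolded is_mp_inverse_def, THEN conjunct2, THEN conjunct1]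
  and X_A_X = X[unfolded is_mp_inverse_def, THEN conjunct2, THEN conjunct2, THEN conjunct1]

text \<open>The range inclusions are recast as vanishing products; the third product vanishes
  because \<open>X k\<close> factors through \<open>adj (A k)\<close>.\<close>

lemma orthogonal:
  assumes "j \<in> I" "k \<in> I" "j \<noteq> k"
  shows adj_A_A: "adj (A j) o\<^sub>L A k = 0"
    and A_adj_A: "A j o\<^sub>L adj (A k) = 0"
    and A_X: "A j o\<^sub>L X k = 0"
proof -
  show "adj (A j) o\<^sub>L A k = 0"
    by (rule blinfun_eqI) (use range_subset[of k j] assms in \<open>auto simp: null_space_def\<close>)
  show *: "A j o\<^sub>L adj (A k) = 0"
    by (rule blinfun_eqI) (use range_adj_subset[of k j] assms in \<open>auto simp: null_space_def\<close>)
  have "A j o\<^sub>L (adj (A k) o\<^sub>L adj (X k) o\<^sub>L X k) = 0"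
    by (simp add: * flip: blinfun_compose_assoc)
  then show "A j o\<^sub>L X k = 0" using assms by (simp add: adj_adj_mp_mp X)
qed

text \<open>Mixed terms vanish by \<open>A_X\<close>; a diagonal term shrinks as
  \<open>adj A A X adj X = adj A adj X = X A\<close>.\<close>

lemma T_S: "T o\<^sub>L S = (\<Sum>k\<in>I. X k o\<^sub>L A k)"
proof -
  have "T o\<^sub>L S = (\<Sum>k\<in>I. (adj (A k) o\<^sub>L A k) o\<^sub>L (X k o\<^sub>L adj (X k)))"
    by (intro sum_compose_sum_orthogonal compose_eq_0_middle finite A_X)
  also have "\<dots> = (\<Sum>k\<in>I. X k o\<^sub>L A k)"
    by (intro sum.cong refl)
      (simp add: adj_op_mp adj_adj_mp X flip: blinfun_compose_assoc)
  finally show ?thesis .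
qed

text \<open>\<open>T\<close>, \<open>S\<close> and every \<open>X k A k\<close> are self-adjoint, so
  this is the adjoint of \<open>T_S\<close>.\<close>

lemma S_T: "S o\<^sub>L T = (\<Sum>k\<in>I. X k o\<^sub>L A k)"
proof -
  have "adj (T o\<^sub>L S) = S o\<^sub>L T"
    by (simp add: adj_compose adj_sum)
  moreover have "adj (\<Sum>k\<in>I. X k o\<^sub>L A k) = (\<Sum>k\<in>I. X k o\<^sub>L A k)"
    by (simp add: adj_sum adj_compose adj_adj_mp X)
  ultimately show ?thesis by (simp add: T_S)
qed

lemma is_mp_inverse_T: "is_mp_inverse T S"
proof (rule is_mp_inverseI)
  have "(T o\<^sub>L S) o\<^sub>L T = (\<Sum>k\<in>I. (X k o\<^sub>L A k) o\<^sub>L (adj (A k) o\<^sub>L A k))"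
    unfolding T_S by (intro sum_compose_sum_orthogonal compose_eq_0_middle finite A_adj_A)
  also have "\<dots> = T"
    by (intro sum.cong refl) (simp add: mp_op_adj X flip: blinfun_compose_assoc)
  finally show "T o\<^sub>L S o\<^sub>L T = T" .
  have "(S o\<^sub>L T) o\<^sub>L S = (\<Sum>k\<in>I. (X k o\<^sub>L A k) o\<^sub>L (X k o\<^sub>L adj (X k)))"
    unfolding S_T by (intro sum_compose_sum_orthogonal compose_eq_0_middle finite A_X)
  also have "\<dots> = S"
    by (intro sum.cong refl) (simp add: X_A_X flip: blinfun_compose_assoc)
  finally show "S o\<^sub>L T o\<^sub>L S = S" .
  show "adj (T o\<^sub>L S) = T o\<^sub>L S" "adj (S o\<^sub>L T) = S o\<^sub>L T"
    by (simp_all add: T_S S_T adj_sum adj_compose adj_adj_mp X)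
qed

lemma mp_inverse_T: "mp_inverse T = S"
  by (rule mp_inverse_eqI) (rule is_mp_inverse_T)

section \<open>Assertions (i) and (ii)\<close>

lemma mp_inverse_eq_diff:
  assumes "i \<in> I"
  shows "X i = (mp_inverse T o\<^sub>L (\<Sum>k\<in>I. adj (A k))) - (\<Sum>k\<in>I - {i}. X k)"
proof -
  \<comment> \<open>\<open>adj (X j) adj (A k)\<close> is the adjoint of \<open>A k X j\<close>.
    With the mixed terms gone, the product is the sum of all \<open>X k\<close>, from which the term
    at \<open>i\<close> is split off.\<close>
  have "(X j o\<^sub>L adj (X j)) o\<^sub>L adj (A k) = 0" if "j \<in> I" "k \<in> I" "j \<noteq> k" for j k
    using A_X[of k j] that by (simp add: blinfun_compose_assoc flip: adj_compose)
  then have "S o\<^sub>L (\<Sum>k\<in>I. adj (A k)) = (\<Sum>k\<in>I. (X k o\<^sub>L adj (X k)) o\<^sub>L adj (A k))"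
    using finite by (rule sum_compose_sum_orthogonal[rotated])
  also have "\<dots> = (\<Sum>k\<in>I. X k)"
    by (intro sum.cong refl) (simp add: mp_adj_mp_adj X)
  also have "\<dots> = X i + (\<Sum>k\<in>I - {i}. X k)" using finite assms by (rule sum.remove)
  finally show ?thesis by (simp add: mp_inverse_T)
qed

lemma T_mp_inverse:
  assumes "i \<in> I"
  shows "T o\<^sub>L X i = adj (A i)"
proof -
  have "T o\<^sub>L X i = (adj (A i) o\<^sub>L A i) o\<^sub>L X i"
    using finite assms by (rule sum_compose_single) (simp add: blinfun_compose_assoc A_X assms)
  then show ?thesis using assms by (simp add: adj_op_mp X)
qed

lemma mp_inverse_T_adj:
  assumes "i \<in> I"
  shows "X i = mp_inverse T o\<^sub>L adj (A i)"
proof -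
  have "S o\<^sub>L adj (A i) = (X i o\<^sub>L adj (X i)) o\<^sub>L adj (A i)"
    using finite assms
    by (rule sum_compose_single) (simp add: blinfun_compose_assoc A_X assms flip: adj_compose)
  then show ?thesis using assms by (simp add: mp_inverse_T mp_adj_mp_adj X)
qed

section \<open>Null spaces and invertibility: assertions (iii) and (iv)\<close>

lemma null_space_sum:
  assumes "J \<subseteq> I"
  shows "null_space (\<Sum>k\<in>J. A k) = (\<Inter>k\<in>J. null_space (A k))"
proof (intro equalityI subsetI INT_I)
  fix x j assume x: "x \<in> null_space (\<Sum>k\<in>J. A k)" and j: "j \<in> J"
  \<comment> \<open>Pairing with \<open>A j x\<close> isolates \<open>(norm (A j x))^2\<close>,
    because the ranges of the \<open>A k\<close> are mutually orthogonal.\<close>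
  have "inner ((\<Sum>k\<in>J. A k) x) (A j x) = (\<Sum>k\<in>J. inner (A k x) (A j x))"
    by (simp add: blinfun.sum_left inner_sum_left)
  also have "\<dots> = (\<Sum>k\<in>J. if k = j then inner (A j x) (A j x) else 0)"
  proof (intro sum.cong refl)
    fix k assume k: "k \<in> J"
    have "adj (A k) (A j x) = 0" if "k \<noteq> j"
      using arg_cong[OF adj_A_A[of k j], of "\<lambda>B. B x"] that j k assms by auto
    then show "inner (A k x) (A j x) = (if k = j then inner (A j x) (A j x) else 0)"
      by (auto simp flip: inner_adj)
  qed
  also have "\<dots> = inner (A j x) (A j x)"
    using j finite_subset[OF assms finite] by simp
  finally show "x \<in> null_space (A j)" using x by (simp add: null_space_def)
qed (simp add: null_space_def blinfun.sum_left)

lemma null_space_T: "null_space T = null_space (\<Sum>k\<in>I. A k)"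
proof -
  have "A k x = 0" if "T x = 0" "k \<in> I" for k x
  proof -
    \<comment> \<open>The quadratic form of \<open>T\<close> is a sum of squares, so each square
      vanishes when \<open>T x = 0\<close>.\<close>
    have "(\<Sum>k\<in>I. inner (A k x) (A k x)) = inner x (T x)"
      by (simp add: blinfun.sum_left inner_sum_right inner_adj)
    then show ?thesis using that finite by (simp add: sum_nonneg_eq_0_iff)
  qed
  then show ?thesis
    unfolding null_space_sum[OF subset_refl] by (auto simp: null_space_def blinfun.sum_left blinfun.zero_right)
qed

lemma null_space_trivial_iff:
  assumes i: "i \<in> I"
  shows "null_space (\<Sum>k\<in>I. A k) = {0} \<longleftrightarrow> range (adj (A i)) = null_space (\<Sum>k\<in>I - {i}. A k)"
proof
  assume trivial: "null_space (\<Sum>k\<in>I. A k) = {0}"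
  show "range (adj (A i)) = null_space (\<Sum>k\<in>I - {i}. A k)"
  proof
    show "range (adj (A i)) \<subseteq> null_space (\<Sum>k\<in>I - {i}. A k)"
      using range_adj_subset i by (subst null_space_sum) blast+
    show "null_space (\<Sum>k\<in>I - {i}. A k) \<subseteq> range (adj (A i))"
    proof
      fix x assume x: "x \<in> null_space (\<Sum>k\<in>I - {i}. A k)"
      \<comment> \<open>\<open>X i (A i x)\<close> is the projection of \<open>x\<close> to the
        range of \<open>adj (A i)\<close>. Removing it makes \<open>A i\<close> vanish and leaves
        the other \<open>A k\<close> at zero, so by triviality of the common null space nothing
        remains.\<close>
      have "A k (x - X i (A i x)) = 0" if k: "k \<in> I" for k
      proof (cases "k = i")
        case True
        then show ?thesis
          using arg_cong[OF A_X_A[OF i], of "\<lambda>B. B x"] by (simp add: blinfun.diff_right)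
      next
        case False
        have "A k x = 0" using x k False by (subst (asm) null_space_sum) (auto simp: null_space_def)
        moreover have "A k (X i (A i x)) = 0"
          using arg_cong[OF A_X[OF k i False], of "\<lambda>B. B (A i x)"] by simp
        ultimately show ?thesis by (simp add: blinfun.diff_right)
      qed
      then have "x - X i (A i x) \<in> null_space (\<Sum>k\<in>I. A k)"
        by (simp add: null_space_sum) (simp add: null_space_def)
      then have "x = X i (A i x)" using trivial by simp
      also have "\<dots> = adj (A i) (adj (X i) x)"
        using arg_cong[OF adj_adj_mp[OF X[OF i]], of "\<lambda>B. B x"] by simp
      finally show "x \<in> range (adj (A i))" by blast
    qed
  qed
next
  assume range: "range (adj (A i)) = null_space (\<Sum>k\<in>I - {i}. A k)"
  have "x = 0" if "x \<in> null_space (\<Sum>k\<in>I. A k)" for x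
  proof -
    have Ax: "A k x = 0" if "k \<in> I" for k
      using \<open>x \<in> _\<close> that by (simp add: null_space_sum) (simp add: null_space_def)
    then have "x \<in> range (adj (A i))"
      unfolding range by (simp add: null_space_def blinfun.sum_left)
    then obtain y where "x = adj (A i) y" by blast
    then have "inner x x = inner (A i x) y" by (simp flip: inner_adj)
    then show ?thesis using Ax i by simp
  qed
  then show "null_space (\<Sum>k\<in>I. A k) = {0}"
    by (auto simp: null_space_def blinfun.zero_right)
qed

text \<open>Injectivity of \<open>T\<close> cancels it from \<open>T S T = T\<close>, so
  \<open>S\<close> is a left inverse; it is also a right inverse since \<open>S\<close> and
  \<open>T\<close> commute.\<close>

lemma op_invertible_T:
  assumes "null_space (\<Sum>k\<in>I. A k) = {0}"
  shows "op_invertible T"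
proof -
  have TST: "T o\<^sub>L S o\<^sub>L T = T" using is_mp_inverse_T by (simp add: is_mp_inverse_def)
  have "(S o\<^sub>L T) x = x" for x
  proof -
    have "T (x - (S o\<^sub>L T) x) = 0"
      using arg_cong[OF TST, of "\<lambda>B. B x"] by (simp add: blinfun.diff_right)
    then have "x - (S o\<^sub>L T) x \<in> null_space T" unfolding null_space_def by (rule CollectI)
    then have "x - (S o\<^sub>L T) x = 0" by (simp only: null_space_T assms singleton_iff)
    then show ?thesis by (simp only: right_minus_eq)
  qed
  then have ST: "S o\<^sub>L T = id_blinfun" by (intro blinfun_eqI) (simp only: blinfun_apply_id_blinfun id_apply)
  then have "T o\<^sub>L S = id_blinfun" by (simp only: T_S S_T)
  with ST show ?thesis unfolding op_invertible_def by blast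
qed

end

subsection \<open>Complex-linear operators\<close>

lemma inner_scaleC_left: "inner (c *\<^sub>C x) y = inner x (cnj c *\<^sub>C y)"
  for x y :: "'a::complex_inner"
proof -
  have "cinner x (cnj c *\<^sub>C y) = cnj (cinner (cnj c *\<^sub>C y) x)" by (rule cinner_commute)
  also have "\<dots> = c * cinner x y"
    by (simp add: cinner_scaleC_left) (metis cinner_commute)
  finally show ?thesis by (simp add: cinner_scaleC_left flip: Re_cinner)
qed

text \<open>With \<open>Re_cinner\<close> this recovers \<open>cinner\<close> from the real inner
  product, so real adjoint identities can be lifted to complex ones.\<close>

lemma Im_cinner: "Im (cinner x y) = - inner (\<i> *\<^sub>C x) y"
  by (simp add: cinner_scaleC_left flip: Re_cinner)

lemma scaleC_zero_right [simp]: "c *\<^sub>C (0::'a::complex_inner) = 0"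
  using scaleC_add_right[of c 0 "0::'a"] by simp

lemma scaleC_sum_right: "c *\<^sub>C (\<Sum>k\<in>I. x k) = (\<Sum>k\<in>I. c *\<^sub>C x k)"
  for x :: "'i \<Rightarrow> 'a::complex_inner"
  by (induction I rule: infinite_finite_induct) (simp_all add: scaleC_add_right)

lemma clinear_op_apply: "clinear_op A \<Longrightarrow> A (c *\<^sub>C x) = c *\<^sub>C A x"
  by (simp add: clinear_op_def)

lemma clinear_op_compose: "clinear_op A \<Longrightarrow> clinear_op B \<Longrightarrow> clinear_op (A o\<^sub>L B)"
  by (simp add: clinear_op_def)

lemma clinear_op_sum: "(\<And>k. k \<in> I \<Longrightarrow> clinear_op (A k)) \<Longrightarrow> clinear_op (\<Sum>k\<in>I. A k)"
  by (simp add: clinear_op_def blinfun.sum_left scaleC_sum_right)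

lemma clinear_op_adj:
  fixes A :: "'a::chilbert_space \<Rightarrow>\<^sub>L 'b::chilbert_space"
  assumes "clinear_op A"
  shows "clinear_op (adj A)"
  unfolding clinear_op_def
proof (intro allI)
  fix c y
  have "inner x (adj A (c *\<^sub>C y)) = inner x (c *\<^sub>C adj A y)" for x
    using inner_scaleC_left[of "cnj c" "A x" y] inner_scaleC_left[of "cnj c" x "adj A y"]
    by (simp add: inner_adj clinear_op_apply[OF assms])
  then show "adj A (c *\<^sub>C y) = c *\<^sub>C adj A y"
    using vector_eq_ldot by blast
qed

text \<open>Real parts agree by \<open>inner_adj\<close>, imaginary parts by complex linearity
  applied to multiplication by the imaginary unit. Uniqueness uses real parts alone.\<close>

lemma cadj_eq_adj:
  fixes A :: "'a::chilbert_space \<Rightarrow>\<^sub>L 'b::chilbert_space"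
  assumes "clinear_op A"
  shows "cadj A = adj A"
  unfolding cadj_def
proof (rule the_equality)
  show "\<forall>x y. cinner (A x) y = cinner x (adj A y)"
    by (simp add: complex_eq_iff Re_cinner Im_cinner inner_adj clinear_op_apply[OF assms])
next
  fix B assume "\<forall>x y. cinner (A x) y = cinner x (blinfun_apply B y)"
  then have "inner (A x) y = inner x (B y)" for x y by (simp flip: Re_cinner)
  then show "B = adj A" by (rule adj_unique[symmetric])
qed

lemma clinear_op_mp_inverse:
  fixes A :: "'a::chilbert_space \<Rightarrow>\<^sub>L 'b::chilbert_space"
  assumes A: "clinear_op A" and X: "is_mp_inverse A X"
  shows "clinear_op X"
  unfolding clinear_op_def
proof (intro allI)
  fix c y
  \<comment> \<open>Both \<open>X (c y)\<close> and \<open>c X y\<close> lie in the range of \<open>adj A\<close>, so it suffices that \<open>A\<close> kills their difference.\<close>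
  define d where "d = X (c *\<^sub>C y) - c *\<^sub>C X y"
  have "adj (A o\<^sub>L X) = A o\<^sub>L X" using X by (simp add: is_mp_inverse_def)
  then have AX_sym: "inner (A (X u)) v = inner u (A (X v))" for u v
    using inner_adj[of u "A o\<^sub>L X" v] by simp
  have AXA: "A (X (A u)) = A u" for u
    using X unfolding is_mp_inverse_def by (metis blinfun_apply_blinfun_compose)
  \<comment> \<open>\<open>A X\<close> is self-adjoint and fixes the range of \<open>A\<close>.
    Moving \<open>c\<close> across as \<open>cnj c\<close> and back reduces both parts of
    \<open>A d\<close> to \<open>inner (c y) (A u)\<close>.\<close>
  have "inner (A d) (A u) = 0" for u
  proof -
    have "inner (A (X (c *\<^sub>C y))) (A u) = inner (c *\<^sub>C y) (A u)"
      by (simp only: AX_sym[of "c *\<^sub>C y"] AXA)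
    moreover have "inner (A (c *\<^sub>C X y)) (A u) = inner (A (X y)) (A (cnj c *\<^sub>C u))"
      by (simp only: clinear_op_apply[OF A] inner_scaleC_left)
    moreover have "\<dots> = inner y (A (cnj c *\<^sub>C u))"
      by (simp only: AX_sym[of y] AXA)
    moreover have "\<dots> = inner (c *\<^sub>C y) (A u)"
      by (simp only: clinear_op_apply[OF A] inner_scaleC_left)
    ultimately show ?thesis by (simp add: d_def blinfun.diff_right inner_diff_left)
  qed
  then have Ad: "A d = 0" by (metis inner_eq_zero_iff)
  have X_eq: "X u = adj A (adj X (X u))" for u
    using arg_cong[OF adj_adj_mp_mp[OF X], of "\<lambda>B. B u"] by simp
  have "d = adj A (adj X (X (c *\<^sub>C y)) - c *\<^sub>C adj X (X y))"
    using X_eq[of "c *\<^sub>C y"] X_eq[of y]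
    by (simp add: d_def blinfun.diff_right clinear_op_apply[OF clinear_op_adj[OF A]])
  then have "inner d d = 0" using Ad by (metis inner_adj inner_zero_left)
  then show "X (c *\<^sub>C y) = c *\<^sub>C X y" by (simp add: d_def)
qed

section \<open>Transfer of the complex notions to the real ones\<close>

lemma cBC_iff: "A \<in> cBC \<longleftrightarrow> clinear_op A \<and> A \<in> BC"
  by (simp add: cBC_def BC_def)

text \<open>Complex linearity of \<open>X\<close>, demanded on the left, is supplied on the right by
  \<open>clinear_op_mp_inverse\<close>.\<close>

lemma is_cmp_inverse_iff:
  assumes "clinear_op A"
  shows "is_cmp_inverse A X \<longleftrightarrow> is_mp_inverse A X"
proof -
  have "is_cmp_inverse A X \<longleftrightarrow> is_mp_inverse A X" if "clinear_op X"
    using assms that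
    by (simp add: is_cmp_inverse_def is_mp_inverse_def cBC_iff cadj_eq_adj clinear_op_compose)
  then show ?thesis
    using clinear_op_mp_inverse[OF assms] by (auto simp: is_cmp_inverse_def cBC_iff)
qed

lemma cmp_inverse_eq: "clinear_op A \<Longrightarrow> cmp_inverse A = mp_inverse A"
  by (simp add: cmp_inverse_def mp_inverse_def is_cmp_inverse_iff)

lemma cop_invertible_iff:
  assumes "clinear_op A"
  shows "cop_invertible A \<longleftrightarrow> op_invertible A"
proof -
  have "clinear_op S" if "S o\<^sub>L A = id_blinfun" "A o\<^sub>L S = id_blinfun" for S
    unfolding clinear_op_def
  proof (intro allI)
    fix c y
    have SA: "S (A u) = u" and AS: "A (S v) = v" for u v
      using that[THEN arg_cong, of "\<lambda>B. B _"] by simp_all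
    have "S (c *\<^sub>C y) = S (c *\<^sub>C A (S y))" by (simp add: AS)
    also have "\<dots> = c *\<^sub>C S y" by (simp add: SA flip: clinear_op_apply[OF assms])
    finally show "S (c *\<^sub>C y) = c *\<^sub>C S y" .
  qed
  then show ?thesis by (auto simp: cop_invertible_def op_invertible_def)
qed

theorem theorem2p3:
  fixes A :: "nat \<Rightarrow> 'a::hilbert_space \<Rightarrow>\<^sub>L 'b::hilbert_space"
    and C :: "nat \<Rightarrow> 'c::chilbert_space \<Rightarrow>\<^sub>L 'd::chilbert_space"
    and K k\<^sub>0 :: nat
  assumes "K > 0" and "k\<^sub>0 \<in> {1..K}"
  shows
   "((\<forall>k\<in>{1..K}. A k \<in> BC) \<and>
      (\<forall>k\<in>{1..K}. \<forall>k'\<in>{1..K}. k \<noteq> k' \<longrightarrow>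
        range (blinfun_apply (A k)) \<subseteq> null_space (adj (A k')) \<and>
        range (blinfun_apply (adj (A k))) \<subseteq> null_space (A k'))
    \<longrightarrow>
      (\<exists>X. is_mp_inverse (\<Sum>k=1..K. adj (A k) o\<^sub>L A k) X) \<and>
      mp_inverse (A k\<^sub>0) =
        (mp_inverse (\<Sum>k=1..K. adj (A k) o\<^sub>L A k) o\<^sub>L (\<Sum>k=1..K. adj (A k)))
          - (\<Sum>k\<in>{1..K} - {k\<^sub>0}. mp_inverse (A k)) \<and>
      (\<Sum>k=1..K. adj (A k) o\<^sub>L A k) o\<^sub>L mp_inverse (A k\<^sub>0) = adj (A k\<^sub>0) \<and>
      mp_inverse (A k\<^sub>0) = mp_inverse (\<Sum>k=1..K. adj (A k) o\<^sub>L A k) o\<^sub>L adj (A k\<^sub>0) \<and>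
      (null_space (\<Sum>k=1..K. A k) = {0} \<longleftrightarrow>
        range (blinfun_apply (adj (A k\<^sub>0))) = null_space (\<Sum>k\<in>{1..K} - {k\<^sub>0}. A k)) \<and>
      (null_space (\<Sum>k=1..K. A k) = {0} \<longrightarrow>
        op_invertible (\<Sum>k=1..K. adj (A k) o\<^sub>L A k)))
    \<and>
    ((\<forall>k\<in>{1..K}. C k \<in> cBC) \<and>
      (\<forall>k\<in>{1..K}. \<forall>k'\<in>{1..K}. k \<noteq> k' \<longrightarrow>
        range (blinfun_apply (C k)) \<subseteq> null_space (cadj (C k')) \<and>
        range (blinfun_apply (cadj (C k))) \<subseteq> null_space (C k'))
    \<longrightarrow>
      (\<exists>X. is_cmp_inverse (\<Sum>k=1..K. cadj (C k) o\<^sub>L C k) X) \<and>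
      cmp_inverse (C k\<^sub>0) =
        (cmp_inverse (\<Sum>k=1..K. cadj (C k) o\<^sub>L C k) o\<^sub>L (\<Sum>k=1..K. cadj (C k)))
          - (\<Sum>k\<in>{1..K} - {k\<^sub>0}. cmp_inverse (C k)) \<and>
      (\<Sum>k=1..K. cadj (C k) o\<^sub>L C k) o\<^sub>L cmp_inverse (C k\<^sub>0) = cadj (C k\<^sub>0) \<and>
      cmp_inverse (C k\<^sub>0) = cmp_inverse (\<Sum>k=1..K. cadj (C k) o\<^sub>L C k) o\<^sub>L cadj (C k\<^sub>0) \<and>
      (null_space (\<Sum>k=1..K. C k) = {0} \<longleftrightarrow>
        range (blinfun_apply (cadj (C k\<^sub>0))) = null_space (\<Sum>k\<in>{1..K} - {k\<^sub>0}. C k)) \<and>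
      (null_space (\<Sum>k=1..K. C k) = {0} \<longrightarrow>
        cop_invertible (\<Sum>k=1..K. cadj (C k) o\<^sub>L C k)))"
proof (intro conjI[where P="_ \<longrightarrow> _"] impI)
  assume "(\<forall>k\<in>{1..K}. A k \<in> BC) \<and>
      (\<forall>k\<in>{1..K}. \<forall>k'\<in>{1..K}. k \<noteq> k' \<longrightarrow>
        range (blinfun_apply (A k)) \<subseteq> null_space (adj (A k')) \<and>
        range (blinfun_apply (adj (A k))) \<subseteq> null_space (A k'))"
  then interpret orthogonal_operators A "{1..K}" by unfold_locales auto
  note i = \<open>k\<^sub>0 \<in> {1..K}\<close>
  show "(\<exists>X. is_mp_inverse (\<Sum>k=1..K. adj (A k) o\<^sub>L A k) X) \<and>
      mp_inverse (A k\<^sub>0) =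
        (mp_inverse (\<Sum>k=1..K. adj (A k) o\<^sub>L A k) o\<^sub>L (\<Sum>k=1..K. adj (A k)))
          - (\<Sum>k\<in>{1..K} - {k\<^sub>0}. mp_inverse (A k)) \<and>
      (\<Sum>k=1..K. adj (A k) o\<^sub>L A k) o\<^sub>L mp_inverse (A k\<^sub>0) = adj (A k\<^sub>0) \<and>
      mp_inverse (A k\<^sub>0) = mp_inverse (\<Sum>k=1..K. adj (A k) o\<^sub>L A k) o\<^sub>L adj (A k\<^sub>0) \<and>
      (null_space (\<Sum>k=1..K. A k) = {0} \<longleftrightarrow>
        range (blinfun_apply (adj (A k\<^sub>0))) = null_space (\<Sum>k\<in>{1..K} - {k\<^sub>0}. A k)) \<and>
      (null_space (\<Sum>k=1..K. A k) = {0} \<longrightarrow>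
        op_invertible (\<Sum>k=1..K. adj (A k) o\<^sub>L A k))"
    by (intro conjI exI[of _ S] is_mp_inverse_T mp_inverse_eq_diff[OF i] T_mp_inverse[OF i]
        mp_inverse_T_adj[OF i] null_space_trivial_iff[OF i] impI op_invertible_T)
next
  assume asm: "(\<forall>k\<in>{1..K}. C k \<in> cBC) \<and>
      (\<forall>k\<in>{1..K}. \<forall>k'\<in>{1..K}. k \<noteq> k' \<longrightarrow>
        range (blinfun_apply (C k)) \<subseteq> null_space (cadj (C k')) \<and>
        range (blinfun_apply (cadj (C k))) \<subseteq> null_space (C k'))"
  then have clinear: "clinear_op (C k)" if "k \<in> {1..K}" for k
    using that by (simp add: cBC_iff)
  then have cadj: "cadj (C k) = adj (C k)" and cmp: "cmp_inverse (C k) = mp_inverse (C k)"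
    if "k \<in> {1..K}" for k
    using that by (simp_all add: cadj_eq_adj cmp_inverse_eq)
  interpret orthogonal_operators C "{1..K}"
    using asm by unfold_locales (auto simp: cBC_iff cadj)
  note i = \<open>k\<^sub>0 \<in> {1..K}\<close>
  have T: "clinear_op T"
    by (intro clinear_op_sum clinear_op_compose clinear_op_adj clinear)
  \<comment> \<open>The pointwise identifications hold only for indices in range, so the sums are
    rewritten as wholes; the goal then becomes the real one.\<close>
  have sums: "(\<Sum>k=1..K. cadj (C k) o\<^sub>L C k) = T" "(\<Sum>k=1..K. cadj (C k)) = (\<Sum>k=1..K. adj (C k))"
      "(\<Sum>k\<in>{1..K} - {k\<^sub>0}. cmp_inverse (C k)) = (\<Sum>k\<in>{1..K} - {k\<^sub>0}. mp_inverse (C k))"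
    by (simp_all add: cadj cmp)
  show "(\<exists>X. is_cmp_inverse (\<Sum>k=1..K. cadj (C k) o\<^sub>L C k) X) \<and>
      cmp_inverse (C k\<^sub>0) =
        (cmp_inverse (\<Sum>k=1..K. cadj (C k) o\<^sub>L C k) o\<^sub>L (\<Sum>k=1..K. cadj (C k)))
          - (\<Sum>k\<in>{1..K} - {k\<^sub>0}. cmp_inverse (C k)) \<and>
      (\<Sum>k=1..K. cadj (C k) o\<^sub>L C k) o\<^sub>L cmp_inverse (C k\<^sub>0) = cadj (C k\<^sub>0) \<and>
      cmp_inverse (C k\<^sub>0) = cmp_inverse (\<Sum>k=1..K. cadj (C k) o\<^sub>L C k) o\<^sub>L cadj (C k\<^sub>0) \<and>
      (null_space (\<Sum>k=1..K. C k) = {0} \<longleftrightarrow>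
        range (blinfun_apply (cadj (C k\<^sub>0))) = null_space (\<Sum>k\<in>{1..K} - {k\<^sub>0}. C k)) \<and>
      (null_space (\<Sum>k=1..K. C k) = {0} \<longrightarrow>
        cop_invertible (\<Sum>k=1..K. cadj (C k) o\<^sub>L C k))"
    unfolding sums cadj[OF i] cmp[OF i] is_cmp_inverse_iff[OF T] cmp_inverse_eq[OF T] cop_invertible_iff[OF T]
    by (intro conjI exI[of _ S] is_mp_inverse_T mp_inverse_eq_diff[OF i] T_mp_inverse[OF i]
        mp_inverse_T_adj[OF i] null_space_trivial_iff[OF i] impI op_invertible_T)
qed

end
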